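(* Let $M,N,m$ be non-negative integers, let $\pi_N$ be a monic polynomial of degree $N$, and let $(P_n)_{n\ge0}$ and $(Q_n)_{n\ge0}$ be two monic orthogonal polynomial sequences forming a $\pi_N$-coherent pair with index $M$ and order $(m,0)$, so that there are complex numbers $c_{n,j}$ for which $$\pi_N(x)P_n^{[m]}(x)=\sum_{j=n-M}^{n+N}c_{n,j}Q_j(x)\quad(n=0,1,\ldots)$$ holds (with $Q_j\equiv0$ if $j<0$), and $c_{n,n-M}\ne0$ if $n\ge M$. Assume further that $m\ge1$ if $N=0$. Let $\mathbf u$ and $\mathbf v$ be the regular functionals with respect to which $(P_n)_{n\ge0}$ and $(Q_n)_{n\ge0}$, respectively, are orthogonal. Then $\mathbf u$ and $\mathbf v$ are semiclassical functionals related by a rational transformation. More precisely, with $\psi(x;n)$ the polynomials defined in the context, set (recursively) $$\Phi(x;j):=\frac{\langle\mathbf v,Q_j^2\rangle\,\psi(x;j)-\sum_{\ell=0}^{j-1}\binom{m}{\ell}Q_j^{(\ell)}(x)\,\Phi(x;\ell)}{j!\binom{m}{j}}\quad(j=0,1,\ldots,m).$$ Then $\deg\Phi(\cdot;0)=M+m$, $\deg\Phi(\cdot;j)\le M+m+j$ for each $j=1,\ldots,m$, and the following hold: $$D\big(\Phi(\cdot;1)\mathbf u\big)=\Phi(\cdot;0)\mathbf u,$$ $$\pi_N\mathbf v=\Phi(\cdot;m)\mathbf u,$$ $$D\big(\Phi(\cdot;m)\pi_N\mathbf v\big)=\big(\Phi(\cdot;m)'+\Phi(\cdot;m-1)\big)\pi_N\mathbf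 v .$$ Moreover, the classes of $\mathbf u$ and $\mathbf v$ satisfy $\mathfrak s(\mathbf u)\le M+m-1$ and $\mathfrak s(\mathbf v)\le N+M+2(m-1)$.
   Context: $\mathcal P$ is the vector space of complex polynomials in one variable; functionals are linear maps $\mathbf w:\mathcal P\to\mathbb C$, with action $\langle\mathbf w,p\rangle$. For a polynomial $\Phi$, $\Phi\mathbf w$ is defined by $\langle\Phi\mathbf w,p\rangle:=\langle\mathbf w,\Phi p\rangle$, and $D\mathbf w$ by $\langle D\mathbf w,p\rangle:=-\langle\mathbf w,p'\rangle$. $f^{(r)}$ is the $r$-th derivative in $x$ of the polynomial $f$. A monic orthogonal polynomial sequence (OPS) with respect to $\mathbf w$ is a sequence $(R_n)_{n\ge0}$ of monic polynomials with $\deg R_n=n$ and $\langle\mathbf w,R_jR_n\rangle=k_n\delta_{j,n}$ with all $k_n\ne0$; $\mathbf w$ is regular if such a sequence exists. Pochhammer symbol: $(\alpha)_0:=1$, $(\alpha)_n:=\alpha(\alpha+1)\cdots(\alpha+n-1)$. Normalized derivative: $P_n^{[m]}(x):=\frac{1}{(n+1)_m}\frac{d^m}{dx^m}P_{n+m}(x)$, monic of degree $n$. A pair of monic OPS is called a $\pi_N$-coherent pair with index $M$ and order $(m,0)$ when it satisfies the structure relation and the condition $c_{n,n-M}\ne0$ ($n\ge M$) displayed in the claim; since all polynomials are monic, $c_{n,n+N}=1$ for all $n$. Polynomials $\psi$ (for $n=0,1,\ldots$; terms with negative summation index are taken to be zero): $$\psi(x;n):=\sum_{j=n-N}^{n+M}\frac{(-1)^m(j+1)_m\,c_{j,n}}{\langle\mathbf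 u,P_{m+j}^2\rangle}P_{m+j}(x).$$ A regular functional $\mathbf w$ is semiclassical if there are nonzero polynomials $\Phi,\Psi$ with $D(\Phi\mathbf w)=\Psi\mathbf w$. The class of a semiclassical $\mathbf w$ is $\mathfrak s(\mathbf w):=\min\max\{\deg\Phi-2,\deg\Psi-1\}$, the minimum being over all pairs $(\Phi,\Psi)$ of nonzero polynomials with $D(\Phi\mathbf w)=\Psi\mathbf w$. Functionals $\mathbf u,\mathbf v$ are related by a rational transformation if there are nonzero polynomials $\Phi,\Psi$ with $\Phi\mathbf u=\Psi\mathbf v$.
   Formalization: The semiclassical claims, the two equations with D and the class bounds are stated only for m ≥ 1; for m = 0 (N ≥ 1) Φ(·;1) and Φ(·;m−1) are undefined and u need not be semiclassical (v = u, Q = P, π = x, u not semiclassical). *)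

theory Defs
  imports Complex_Main "HOL-Computational_Algebra.Polynomial"
begin

text \<open>The set of functionals is the algebraic dual of the complex polynomials; two functionals are
  equal iff they agree on every polynomial, i.e. iff they are equal as functions.\<close>

type_synonym pfun = "complex poly \<Rightarrow> complex"

definition is_functional :: "pfun \<Rightarrow> bool" where
  "is_functional w \<longleftrightarrow> Vector_Spaces.linear smult (*) w"

definition pmult :: "complex poly \<Rightarrow> pfun \<Rightarrow> pfun"  (infixr \<open>\<cdot>\<^sub>f\<close> 75) where
  "\<Phi> \<cdot>\<^sub>f w = (\<lambda>p. w (\<Phi> * p))"

definition fderiv :: "pfun \<Rightarrow> pfun" where
  "fderiv w = (\<lambda>p. - w (pderiv p))"

definition monic :: "complex poly \<Rightarrow> bool" where
  "monic p \<longleftrightarrow> lead_coeff p = 1"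

definition monic_OPS :: "pfun \<Rightarrow> (nat \<Rightarrow> complex poly) \<Rightarrow> bool" where
  "monic_OPS w R \<longleftrightarrow> is_functional w \<and> (\<forall>n. monic (R n) \<and> degree (R n) = n) \<and>
     (\<exists>k. (\<forall>n. k n \<noteq> 0) \<and> (\<forall>j n. w (R j * R n) = (if j = n then k n else 0)))"

definition regular :: "pfun \<Rightarrow> bool" where
  "regular w \<longleftrightarrow> (\<exists>R. monic_OPS w R)"

definition pearson :: "pfun \<Rightarrow> complex poly \<Rightarrow> complex poly \<Rightarrow> bool" where
  "pearson w \<Phi> \<Psi> \<longleftrightarrow> \<Phi> \<noteq> 0 \<and> \<Psi> \<noteq> 0 \<and> fderiv (\<Phi> \<cdot>\<^sub>f w) = \<Psi> \<cdot>\<^sub>f w"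

definition semiclassical :: "pfun \<Rightarrow> bool" where
  "semiclassical w \<longleftrightarrow> regular w \<and> (\<exists>\<Phi> \<Psi>. pearson w \<Phi> \<Psi>)"

text \<open>Integer-valued, so that the subtractions are not truncated.  The values over which the minimum
  is taken are bounded below by -1, so for semiclassical functionals it is attained; for other
  functionals the value is unspecified.\<close>

definition sclass :: "pfun \<Rightarrow> int" where
  "sclass w = (LEAST s. \<exists>\<Phi> \<Psi>. pearson w \<Phi> \<Psi> \<and>
     s = max (int (degree \<Phi>) - 2) (int (degree \<Psi>) - 1))"

definition rationally_related :: "pfun \<Rightarrow> pfun \<Rightarrow> bool" where
  "rationally_related u v \<longleftrightarrow> (\<exists>\<Phi> \<Psi>. \<Phi> \<noteq> 0 \<and> \<Psi> \<noteq> 0 \<and> \<Phi> \<cdot>\<^sub>f u = \<Psi> \<cdot>\<^sub>f v)"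

definition normalized_deriv :: "(nat \<Rightarrow> complex poly) \<Rightarrow> nat \<Rightarrow> nat \<Rightarrow> complex poly" where
  "normalized_deriv P m n = smult (1 / pochhammer (of_nat (n + 1)) m) ((pderiv ^^ m) (P (n + m)))"

text \<open>The lower summation bounds \<open>n - M\<close> and \<open>n - N\<close> below are truncated at 0, which is exactly the
  convention that terms with negative index vanish.  Orthogonality of the two sequences is not part
  of this predicate.\<close>

definition coherent_relation ::
  "complex poly \<Rightarrow> nat \<Rightarrow> nat \<Rightarrow> (nat \<Rightarrow> complex poly) \<Rightarrow> (nat \<Rightarrow> complex poly) \<Rightarrow>
   (nat \<Rightarrow> nat \<Rightarrow> complex) \<Rightarrow> bool" where
  "coherent_relation \<pi> M m P Q c \<longleftrightarrow>
     (\<forall>n. \<pi> * normalized_deriv P m n = (\<Sum>j = n - M..n + degree \<pi>. smult (c n j) (Q j))) \<and>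
     (\<forall>n\<ge>M. c n (n - M) \<noteq> 0)"

definition psi_poly ::
  "pfun \<Rightarrow> (nat \<Rightarrow> complex poly) \<Rightarrow> (nat \<Rightarrow> nat \<Rightarrow> complex) \<Rightarrow> nat \<Rightarrow> nat \<Rightarrow> nat \<Rightarrow> nat \<Rightarrow> complex poly"
where
  "psi_poly u P c N M m n =
     (\<Sum>j = n - N..n + M.
        smult ((-1) ^ m * pochhammer (of_nat (j + 1)) m * c j n / u ((P (m + j))\<^sup>2)) (P (m + j)))"

text \<open>Only the values for \<open>j \<le> m\<close> are meaningful: beyond that \<open>m choose j = 0\<close>.\<close>

fun Phi_poly ::
  "pfun \<Rightarrow> pfun \<Rightarrow> (nat \<Rightarrow> complex poly) \<Rightarrow> (nat \<Rightarrow> complex poly) \<Rightarrow> (nat \<Rightarrow> nat \<Rightarrow> complex) \<Rightarrow>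
   nat \<Rightarrow> nat \<Rightarrow> nat \<Rightarrow> nat \<Rightarrow> complex poly"
where
  "Phi_poly u v P Q c N M m j =
     smult (1 / (fact j * of_nat (m choose j)))
       (smult (v ((Q j)\<^sup>2)) (psi_poly u P c N M m j)
        - (\<Sum>l<j. smult (of_nat (m choose l)) ((pderiv ^^ l) (Q j) * Phi_poly u v P Q c N M m l)))"

declare Phi_poly.simps [simp del]

end

theory Submission
  imports Defs
begin

text \<open>Put \<open>w = \<pi> v\<close>.  Testing on the basis \<open>P\<^sub>k\<close> and using the structure relation gives
  \<open>D\<^sup>m (Q\<^sub>n w) = \<langle>v, Q\<^sub>n\<^sup>2\<rangle> \<psi>(\<cdot>; n) u\<close> for every \<open>n\<close>.  Expanding the left-hand side by the Leibniz rule
  for \<open>n = 0, \<dots>, m\<close> yields a triangular system for the derivatives of \<open>w\<close>; the recursion defining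
  \<open>\<Phi>\<close> solves it, so that \<open>D\<^bsup>m-j\<^esup> w = \<Phi>(\<cdot>; j) u\<close>.  The cases \<open>j = 0, 1, m - 1, m\<close> are the claimed
  equations, and regularity keeps the polynomials in the resulting Pearson equations nonzero.\<close>

section \<open>Functionals and their derivatives\<close>

lemma functional_add: "is_functional w \<Longrightarrow> w (p + q) = w p + w q"
  unfolding is_functional_def Vector_Spaces.linear_iff by blast

lemma functional_smult: "is_functional w \<Longrightarrow> w (smult a p) = a * w p"
  unfolding is_functional_def Vector_Spaces.linear_iff by blast

lemma functional_0: "is_functional w \<Longrightarrow> w 0 = 0"
  using functional_smult[of w 0 0] by simp

lemma functional_minus: "is_functional w \<Longrightarrow> w (- p) = - w p"
  using functional_smult[of w "-1" p] by simp

lemma functional_diff: "is_functional w \<Longrightarrow> w (p - q) = w p - w q"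
  using functional_add[of w p "- q"] functional_minus[of w q] by simp

lemma functional_sum: "is_functional w \<Longrightarrow> w (\<Sum>i\<in>A. f i) = (\<Sum>i\<in>A. w (f i))"
  by (induction A rule: infinite_finite_induct) (auto simp: functional_0 functional_add)

text \<open>\<open>is_functional\<close> bundles the vector space axioms for both scalings. They
  always hold, which leaves additivity and homogeneity to check.\<close>

lemma is_functionalI:
  assumes "\<And>p q. w (p + q) = w p + w q" "\<And>a p. w (smult a p) = a * w p"
  shows "is_functional w"
proof -
  have "vector_space (smult :: complex \<Rightarrow> complex poly \<Rightarrow> complex poly)"
    by unfold_locales (auto simp: smult_add_right smult_add_left)
  moreover have "vector_space ((*) :: complex \<Rightarrow> complex \<Rightarrow> complex)"
    by unfold_locales (auto simp: algebra_simps)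
  ultimately show ?thesis
    using assms unfolding is_functional_def Vector_Spaces.linear_iff by blast
qed

lemma functional_pmult: "is_functional w \<Longrightarrow> is_functional (p \<cdot>\<^sub>f w)"
  by (intro is_functionalI)
    (auto simp: pmult_def functional_add functional_smult distrib_left)

lemma functional_fderiv: "is_functional w \<Longrightarrow> is_functional (fderiv w)"
  by (intro is_functionalI)
    (auto simp: fderiv_def functional_add functional_smult pderiv_add pderiv_smult)

lemma functional_funpow_fderiv: "is_functional w \<Longrightarrow> is_functional ((fderiv ^^ n) w)"
  by (induction n) (auto intro: functional_fderiv)

lemma funpow_fderiv_eq: "(fderiv ^^ n) w p = (-1) ^ n * w ((pderiv ^^ n) p)"
  by (induction n arbitrary: w p) (auto simp: fderiv_def funpow_swap1)

lemma pmult_pmult: "p \<cdot>\<^sub>f q \<cdot>\<^sub>f w = (p * q) \<cdot>\<^sub>f w"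
  by (auto simp: pmult_def ac_simps)

lemma fderiv_pmult:
  "is_functional w \<Longrightarrow> fderiv (p \<cdot>\<^sub>f w) q = (pderiv p \<cdot>\<^sub>f w) q + (p \<cdot>\<^sub>f fderiv w) q"
  by (simp add: fderiv_def pmult_def pderiv_mult functional_add ac_simps)

text \<open>Sums of functionals are handled argument by argument, hence the pointwise
  hypothesis.\<close>

lemma funpow_fderiv_add:
  assumes "\<And>q. w q = w1 q + w2 q"
  shows "(fderiv ^^ n) w q = (fderiv ^^ n) w1 q + (fderiv ^^ n) w2 q"
  by (simp add: funpow_fderiv_eq assms distrib_left)

text \<open>Pascal's rule in the shape that the induction step of the Leibniz rule produces.\<close>

lemma sum_binomial_Suc:
  fixes g :: "nat \<Rightarrow> 'a :: comm_semiring_1"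
  shows "(\<Sum>l\<le>Suc n. of_nat (Suc n choose l) * g l) =
    (\<Sum>l\<le>n. of_nat (n choose l) * g (Suc l)) + (\<Sum>l\<le>n. of_nat (n choose l) * g l)"
proof -
  \<comment> \<open>The added term is zero because \<open>n choose Suc n = 0\<close>; with it,
    splitting off \<open>l = 0\<close> leaves a sum over \<open>l \<le> n\<close>.\<close>
  have "(\<Sum>l\<le>Suc n. of_nat (n choose l) * g l) = (\<Sum>l\<le>n. of_nat (n choose l) * g l)"
    by (simp add: binomial_eq_0)
  then have "(\<Sum>l\<le>n. of_nat (n choose l) * g l) =
      g 0 + (\<Sum>l\<le>n. of_nat (n choose Suc l) * g (Suc l))"
    by (simp only: sum.atMost_Suc_shift) simp
  then show ?thesis
    by (simp only: sum.atMost_Suc_shift) (simp add: sum.distrib algebra_simps)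
qed

text \<open>The induction peels off the innermost derivative, which replaces the pair
  \<open>p\<close>, \<open>w\<close> by \<open>pderiv p\<close>, \<open>w\<close> and by
  \<open>p\<close>, \<open>fderiv w\<close>; hence both must be arbitrary.\<close>

lemma Leibniz_functional:
  assumes "is_functional w"
  shows "(fderiv ^^ n) (p \<cdot>\<^sub>f w) q =
    (\<Sum>l\<le>n. of_nat (n choose l) * ((pderiv ^^ l) p \<cdot>\<^sub>f (fderiv ^^ (n - l)) w) q)"
  using assms
proof (induction n arbitrary: p w)
  case 0
  then show ?case by simp
next
  case (Suc n)
  define g where "g l = ((pderiv ^^ l) p \<cdot>\<^sub>f (fderiv ^^ (Suc n - l)) w) q" for l
  have "(fderiv ^^ Suc n) (p \<cdot>\<^sub>f w) q = (fderiv ^^ n) (fderiv (p \<cdot>\<^sub>f w)) q"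
    by (simp add: funpow_swap1)
  also have "\<dots> = (fderiv ^^ n) (pderiv p \<cdot>\<^sub>f w) q + (fderiv ^^ n) (p \<cdot>\<^sub>f fderiv w) q"
    using fderiv_pmult[OF Suc.prems] by (rule funpow_fderiv_add)
  also have "(fderiv ^^ n) (pderiv p \<cdot>\<^sub>f w) q = (\<Sum>l\<le>n. of_nat (n choose l) * g (Suc l))"
    using Suc.IH[OF Suc.prems, of "pderiv p"] by (simp add: g_def funpow_swap1)
  also have "(fderiv ^^ n) (p \<cdot>\<^sub>f fderiv w) q = (\<Sum>l\<le>n. of_nat (n choose l) * g l)"
    unfolding Suc.IH[OF functional_fderiv[OF Suc.prems], of p]
    by (intro sum.cong) (auto simp: g_def Suc_diff_le funpow_swap1)
  finally show ?case
    unfolding sum_binomial_Suc[of n g, symmetric] by (simp only: g_def)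
qed

text \<open>Supplies the diagonal entries of the triangular system, and so the factor
  \<open>fact j\<close> in the denominator of \<open>\<Phi> j\<close>.\<close>

lemma higher_pderiv_monic:
  assumes "monic p" "degree p = n"
  shows "(pderiv ^^ n) p = [:fact n:]"
proof -
  have "degree ((pderiv ^^ n) p) = 0"
    using assms by (simp add: degree_higher_pderiv)
  moreover have "coeff ((pderiv ^^ n) p) 0 = fact n"
    using assms by (simp add: coeff_higher_pderiv monic_def pochhammer_fact)
  ultimately show ?thesis
    by (metis degree_eq_zeroE coeff_pCons_0)
qed

text \<open>Surjectivity of \<open>pderiv\<close> lets a functional that vanishes on all derivatives
  be recognised as zero.\<close>

lemma ex_antiderivative:
  fixes p :: "'a :: field_char_0 poly"
  obtains q where "pderiv q = p"
proof
  have "of_nat (Suc i) \<noteq> (0 :: 'a)" for i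
    using of_nat_neq_0 by blast
  then have "pderiv (\<Sum>i\<le>degree p. monom (coeff p i / of_nat (Suc i)) (Suc i)) =
      (\<Sum>i\<le>degree p. monom (coeff p i) i)"
    by (simp add: higher_pderiv_sum[of 1, simplified] pderiv_monom del: of_nat_Suc)
  then show "pderiv (\<Sum>i\<le>degree p. monom (coeff p i / of_nat (Suc i)) (Suc i)) = p"
    by (simp add: poly_as_sum_of_monoms)
qed

section \<open>Orthogonal polynomial sequences\<close>

lemma monic_OPS_functional: "monic_OPS w R \<Longrightarrow> is_functional w"
  by (simp add: monic_OPS_def)

lemma monic_OPS_monic: "monic_OPS w R \<Longrightarrow> monic (R n)"
  by (simp add: monic_OPS_def)

lemma monic_OPS_degree: "monic_OPS w R \<Longrightarrow> degree (R n) = n"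
  by (simp add: monic_OPS_def)

lemma monic_OPS_square: "monic_OPS w R \<Longrightarrow> w ((R n)\<^sup>2) \<noteq> 0"
  unfolding monic_OPS_def power2_eq_square by auto

lemma monic_OPS_orthogonal:
  "monic_OPS w R \<Longrightarrow> w (R j * R n) = (if j = n then w ((R n)\<^sup>2) else 0)"
  unfolding monic_OPS_def power2_eq_square by auto

text \<open>Cancelling the leading term drives every induction on the degree below. The case
  \<open>q = 0\<close> is separate because a constant \<open>p\<close> leaves no smaller
  degree.\<close>

lemma monic_split:
  assumes "monic r" "degree r = degree p"
  obtains q where "p = smult (lead_coeff p) r + q" "q = 0 \<or> degree q < degree p"
proof
  let ?q = "p - smult (lead_coeff p) r"
  show "p = smult (lead_coeff p) r + ?q" by simp
  have "degree ?q \<le> degree p"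
    using assms by (intro degree_diff_le) auto
  moreover have "coeff ?q (degree p) = 0"
    using assms by (simp add: monic_def)
  ultimately show "?q = 0 \<or> degree ?q < degree p"
    by (metis leading_coeff_0_iff le_neq_implies_less)
qed

lemma functional_eqI:
  assumes w: "is_functional w1" "is_functional w2"
    and R: "\<And>n. monic (R n)" "\<And>n. degree (R n) = n"
    and eq: "\<And>n. w1 (R n) = w2 (R n)"
  shows "w1 = w2"
proof
  fix p show "w1 p = w2 p"
  proof (induction "degree p" arbitrary: p rule: less_induct)
    case less
    obtain q where q: "p = smult (lead_coeff p) (R (degree p)) + q" "q = 0 \<or> degree q < degree p"
      using monic_split[of "R (degree p)" p] R by metis
    have "w1 q = w2 q"
      using q(2) less w by (auto simp: functional_0)
    then show ?case
      by (subst (1 2) q(1)) (simp add: w functional_add functional_smult eq)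
  qed
qed

lemma monic_OPS_lower:
  assumes "monic_OPS w R" "degree p < n"
  shows "w (p * R n) = 0"
  using assms(2)
proof (induction "degree p" arbitrary: p rule: less_induct)
  case less
  obtain q where q: "p = smult (lead_coeff p) (R (degree p)) + q" "q = 0 \<or> degree q < degree p"
    using monic_split[of "R (degree p)" p] monic_OPS_monic monic_OPS_degree assms(1) by metis
  note w = monic_OPS_functional[OF assms(1)]
  have "w (q * R n) = 0"
    using q(2) less.hyps[of q] less.prems by (auto simp: functional_0 w)
  moreover have "w (R (degree p) * R n) = 0"
    using less.prems by (simp add: monic_OPS_orthogonal[OF assms(1)])
  ultimately have "w ((smult (lead_coeff p) (R (degree p)) + q) * R n) = 0"
    by (simp add: w distrib_right functional_add functional_smult)
  then show ?case
    by (simp only: q(1)[symmetric])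
qed

text \<open>Testing against \<open>R n\<close> with \<open>n = degree p\<close> isolates the leading
  coefficient: the remainder has lower degree and is orthogonal to \<open>R n\<close>.\<close>

lemma regular_pmult_eq_0:
  assumes "regular w" "\<And>q. w (p * q) = 0"
  shows "p = 0"
proof -
  obtain R where R: "monic_OPS w R"
    using assms(1) by (auto simp: regular_def)
  let ?n = "degree p"
  note w = monic_OPS_functional[OF R]
  obtain q where q: "p = smult (lead_coeff p) (R ?n) + q" "q = 0 \<or> degree q < ?n"
    using monic_split[of "R ?n" p] monic_OPS_monic monic_OPS_degree R by metis
  have "w (q * R ?n) = 0"
    using q(2) monic_OPS_lower[OF R] w by (auto simp: functional_0)
  then have "w (p * R ?n) = lead_coeff p * w ((R ?n)\<^sup>2)"
    by (subst q(1))
      (simp add: w distrib_right functional_add functional_smult power2_eq_square)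
  then show ?thesis
    using assms(2) monic_OPS_square[OF R] by simp
qed

text \<open>By regularity the two polynomials vanish together, so nonvanishing has to be proved for
  only one of them.\<close>

lemma pearson_iff:
  assumes "regular w" "fderiv (p \<cdot>\<^sub>f w) = q \<cdot>\<^sub>f w"
  shows "pearson w p q \<longleftrightarrow> p \<noteq> 0" and "p = 0 \<longleftrightarrow> q = 0"
proof -
  have *: "- w (p * pderiv r) = w (q * r)" for r
    using fun_cong[OF assms(2), of r] by (simp add: fderiv_def pmult_def)
  have w: "is_functional w"
    using assms(1) monic_OPS_functional by (auto simp: regular_def)
  show "p = 0 \<longleftrightarrow> q = 0"
  proof
    assume "p = 0"
    then have "w (q * r) = 0" for r
      using *[of r] by (simp add: functional_0 w)
    then show "q = 0"
      by (rule regular_pmult_eq_0[OF assms(1)])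
  next
    assume "q = 0"
    have "w (p * s) = 0" for s
    proof -
      \<comment> \<open>The equation only controls \<open>w\<close> on products of \<open>p\<close>
        with a derivative, but every polynomial \<open>s\<close> is a derivative.\<close>
      obtain r where "pderiv r = s" by (rule ex_antiderivative)
      then show ?thesis
        using *[of r] \<open>q = 0\<close> by (simp add: functional_0 w)
    qed
    then show "p = 0"
      by (rule regular_pmult_eq_0[OF assms(1)])
  qed
  then show "pearson w p q \<longleftrightarrow> p \<noteq> 0"
    using assms(2) by (auto simp: pearson_def)
qed

text \<open>The integers are not well-ordered, so \<open>LEAST\<close> says nothing until a minimum
  is known to exist. The values are at least -1, and the shift \<open>f\<close> carries the search
  to the naturals.\<close>

lemma sclass_le:
  assumes "pearson w p q"
  shows "sclass w \<le> max (int (degree p) - 2) (int (degree q) - 1)"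
proof -
  define S where "S s \<longleftrightarrow> (\<exists>p q. pearson w p q \<and>
     s = max (int (degree p) - 2) (int (degree q) - 1))" for s
  define f where "f k = int k - 1" for k
  have lb: "s \<ge> -1" if "S s" for s
    using that by (auto simp: S_def)
  let ?s = "max (int (degree p) - 2) (int (degree q) - 1)"
  have S: "S ?s" using assms by (auto simp: S_def)
  define k where "k = (LEAST k. S (f k))"
  have f: "S s \<Longrightarrow> f (nat (s + 1)) = s" for s
    using lb[of s] by (simp add: f_def)
  have "S (f k)"
    unfolding k_def by (rule LeastI[of _ "nat (?s + 1)"]) (simp add: f[OF S] S)
  moreover have "f k \<le> s" if "S s" for s
  proof -
    have "k \<le> nat (s + 1)"
      unfolding k_def by (rule Least_le) (simp add: f[OF that] that)
    then show ?thesis using lb[OF that] by (simp add: f_def)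
  qed
  ultimately have "(LEAST s. S s) = f k"
    by (intro Least_equality)
  then have "sclass w = f k"
    by (simp add: sclass_def S_def)
  then show ?thesis
    using \<open>\<And>s. S s \<Longrightarrow> f k \<le> s\<close>[OF S] by simp
qed

section \<open>Coherent pairs\<close>

locale coherent_pair =
  fixes M m :: nat and \<pi> :: "complex poly"
    and P Q :: "nat \<Rightarrow> complex poly" and c :: "nat \<Rightarrow> nat \<Rightarrow> complex" and u v :: pfun
  assumes monic_pi: "monic \<pi>"
    and P: "monic_OPS u P" and Q: "monic_OPS v Q"
    and coherent: "coherent_relation \<pi> M m P Q c"
begin

abbreviation "N \<equiv> degree \<pi>"
abbreviation "\<psi> \<equiv> psi_poly u P c N M m"
abbreviation "\<Phi> \<equiv> Phi_poly u v P Q c N M m"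

lemma u: "is_functional u" and v: "is_functional v"
  using P Q by (auto simp: monic_OPS_functional)

section \<open>Transfer of the structure relation to the functionals\<close>

lemma pochhammer_nonzero: "pochhammer (of_nat (Suc j) :: complex) m \<noteq> 0"
  by (simp add: pochhammer_of_nat pochhammer_pos del: of_nat_Suc)

lemma v_normalized_deriv:
  "v (\<pi> * Q n * normalized_deriv P m j) =
     (if n \<in> {j - M..j + N} then c j n * v ((Q n)\<^sup>2) else 0)"
proof -
  have "v (\<pi> * Q n * normalized_deriv P m j) = v (Q n * (\<pi> * normalized_deriv P m j))"
    by (simp add: ac_simps)
  also have "\<dots> = v (\<Sum>i=j - M..j + N. smult (c j i) (Q n * Q i))"
    using coherent by (simp add: coherent_relation_def sum_distrib_left)
  also have "\<dots> = (\<Sum>i=j - M..j + N. if n = i then c j i * v ((Q i)\<^sup>2) else 0)"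
    unfolding functional_sum[OF v] functional_smult[OF v] monic_OPS_orthogonal[OF Q]
    by (intro sum.cong) auto
  finally show ?thesis by simp
qed

text \<open>The division by \<open>u ((P (m + j))\<^sup>2)\<close> in \<open>psi_poly\<close>
  cancels the norm that orthogonality produces.\<close>

lemma u_psi:
  "u (\<psi> n * P (m + j)) =
     (if j \<in> {n - N..n + M} then (-1) ^ m * pochhammer (of_nat (j + 1)) m * c j n else 0)"
proof -
  have "u (\<psi> n * P (m + j)) = (\<Sum>i=n - N..n + M.
      if i = j then (-1) ^ m * pochhammer (of_nat (i + 1)) m * c i n else 0)"
    unfolding psi_poly_def sum_distrib_right functional_sum[OF u] mult_smult_left
      functional_smult[OF u] monic_OPS_orthogonal[OF P]
    by (intro sum.cong) (auto simp: monic_OPS_square[OF P])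
  then show ?thesis by simp
qed

text \<open>Only \<open>P i\<close> with \<open>i \<ge> m\<close> occur in \<open>\<psi> n\<close>;
  this mirrors the fact that the \<open>m\<close>-th derivative kills degrees below
  \<open>m\<close>.\<close>

lemma u_psi_low:
  assumes "k < m"
  shows "u (\<psi> n * P k) = 0"
  unfolding psi_poly_def sum_distrib_right functional_sum[OF u] mult_smult_left
      functional_smult[OF u] monic_OPS_orthogonal[OF P]
  using assms by (intro sum.neutral) auto

lemma funpow_fderiv_Q:
  "(fderiv ^^ m) (Q n \<cdot>\<^sub>f \<pi> \<cdot>\<^sub>f v) = smult (v ((Q n)\<^sup>2)) (\<psi> n) \<cdot>\<^sub>f u"
proof (rule functional_eqI)
  show "is_functional ((fderiv ^^ m) (Q n \<cdot>\<^sub>f \<pi> \<cdot>\<^sub>f v))"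
    by (intro functional_funpow_fderiv functional_pmult v)
  show "is_functional (smult (v ((Q n)\<^sup>2)) (\<psi> n) \<cdot>\<^sub>f u)"
    by (intro functional_pmult u)
  show "monic (P k)" "degree (P k) = k" for k
    using P by (auto simp: monic_OPS_monic monic_OPS_degree)
  fix k
  have lhs: "(fderiv ^^ m) (Q n \<cdot>\<^sub>f \<pi> \<cdot>\<^sub>f v) (P k) = (-1) ^ m * v (\<pi> * Q n * (pderiv ^^ m) (P k))"
    by (simp add: funpow_fderiv_eq pmult_def ac_simps)
  have rhs: "(smult (v ((Q n)\<^sup>2)) (\<psi> n) \<cdot>\<^sub>f u) (P k) = v ((Q n)\<^sup>2) * u (\<psi> n * P k)"
    by (simp add: pmult_def functional_smult u)
  show "(fderiv ^^ m) (Q n \<cdot>\<^sub>f \<pi> \<cdot>\<^sub>f v) (P k) = (smult (v ((Q n)\<^sup>2)) (\<psi> n) \<cdot>\<^sub>f u) (P k)"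
  proof (cases "k < m")
    case True
    then have "(pderiv ^^ m) (P k) = 0"
      using monic_OPS_degree[OF P, of k]
      by (intro poly_eqI) (simp add: coeff_higher_pderiv coeff_eq_0)
    then show ?thesis
      unfolding lhs rhs by (simp add: u_psi_low True functional_0 v)
  next
    case False
    then obtain j where k: "k = m + j"
      using le_Suc_ex not_less by blast
    have "(pderiv ^^ m) (P k) = smult (pochhammer (of_nat (j + 1)) m) (normalized_deriv P m j)"
      using pochhammer_nonzero[of j] by (simp add: normalized_deriv_def k add.commute)
    \<comment> \<open>The structure relation bounds the column index of \<open>c\<close> by its row
      index; \<open>\<psi> n\<close> sums down column \<open>n\<close>, so the band is read the
      other way round. Truncated subtraction does no harm.\<close>
    moreover have "n \<in> {j - M..j + N} \<longleftrightarrow> j \<in> {n - N..n + M}"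
      by auto
    ultimately show ?thesis
      unfolding lhs rhs by (simp add: k u_psi v_normalized_deriv functional_smult v)
  qed
qed

text \<open>In the Leibniz expansion for \<open>Q j\<close>, the terms \<open>l > j\<close> vanish
  because \<open>Q j\<close> has degree \<open>j\<close>, those with \<open>l < j\<close> are known
  by induction, and \<open>l = j\<close> contains the wanted derivative. Solving for it is the
  recursion for \<open>\<Phi> j\<close>.\<close>

lemma funpow_fderiv_pi:
  assumes "j \<le> m"
  shows "(fderiv ^^ (m - j)) (\<pi> \<cdot>\<^sub>f v) = \<Phi> j \<cdot>\<^sub>f u"
  using assms
proof (induction j rule: less_induct)
  case (less j)
  define w where "w = \<pi> \<cdot>\<^sub>f v"
  have w: "is_functional w"
    by (simp add: w_def functional_pmult v)
  define b :: complex where "b = fact j * of_nat (m choose j)"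
  \<comment> \<open>Here \<open>j \<le> m\<close> matters: it keeps \<open>m choose j\<close>
    nonzero.\<close>
  have b: "b \<noteq> 0" using less.prems by (simp add: b_def)
  show ?case
  proof
    fix q
    define g where "g l = of_nat (m choose l) * ((pderiv ^^ l) (Q j) \<cdot>\<^sub>f (fderiv ^^ (m - l)) w) q"
      for l
    have "v ((Q j)\<^sup>2) * u (\<psi> j * q) = (\<Sum>l\<le>m. g l)"
      using fun_cong[OF funpow_fderiv_Q[of j], of q] Leibniz_functional[OF w, of m "Q j" q]
      by (simp add: pmult_def functional_smult u g_def w_def)
    also have "\<dots> = (\<Sum>l\<le>j. g l)"
    proof (rule sum.mono_neutral_right)
      show "\<forall>l\<in>{..m} - {..j}. g l = 0"
      proof
        fix l assume "l \<in> {..m} - {..j}"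
        then have "(pderiv ^^ l) (Q j) = 0"
          using monic_OPS_degree[OF Q, of j]
          by (intro poly_eqI) (simp add: coeff_higher_pderiv coeff_eq_0)
        then show "g l = 0"
          by (simp add: g_def pmult_def functional_0 functional_funpow_fderiv w)
      qed
    qed (use less.prems in auto)
    also have "\<dots> = g j + (\<Sum>l<j. g l)"
      by (simp add: lessThan_Suc_atMost[symmetric])
    also have "g j = b * (fderiv ^^ (m - j)) w q"
      using higher_pderiv_monic[OF monic_OPS_monic[OF Q] monic_OPS_degree[OF Q], of j]
      by (simp add: g_def pmult_def b_def functional_smult functional_funpow_fderiv w)
    also have "(\<Sum>l<j. g l) =
        u ((\<Sum>l<j. smult (of_nat (m choose l)) ((pderiv ^^ l) (Q j) * \<Phi> l)) * q)"
      unfolding sum_distrib_right functional_sum[OF u]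
    proof (intro sum.cong refl)
      fix l assume "l \<in> {..<j}"
      then have "(fderiv ^^ (m - l)) w = \<Phi> l \<cdot>\<^sub>f u"
        using less by (simp add: w_def)
      then show "g l = u (smult (of_nat (m choose l)) ((pderiv ^^ l) (Q j) * \<Phi> l) * q)"
        by (simp add: g_def pmult_def functional_smult u ac_simps)
    qed
    finally have "b * (fderiv ^^ (m - j)) w q = b * u (\<Phi> j * q)"
      using b
      by (subst Phi_poly.simps)
        (simp add: b_def[symmetric] functional_smult functional_diff u left_diff_distrib)
    then show "(fderiv ^^ (m - j)) (\<pi> \<cdot>\<^sub>f v) q = (\<Phi> j \<cdot>\<^sub>f u) q"
      using b by (simp add: w_def pmult_def)
  qed
qed

section \<open>Degrees of the polynomials \<open>\<Phi> j\<close>\<close>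

lemma degree_psi: "degree (\<psi> n) \<le> M + m + n"
  unfolding psi_poly_def
  by (intro degree_sum_le order.trans[OF degree_smult_le])
    (auto simp: monic_OPS_degree[OF P])

lemma degree_Phi: "degree (\<Phi> j) \<le> M + m + j"
proof (induction j rule: less_induct)
  case (less j)
  have "degree ((pderiv ^^ l) (Q j) * \<Phi> l) \<le> M + m + j" if "l < j" for l
  proof -
    have "degree ((pderiv ^^ l) (Q j) * \<Phi> l) \<le> (j - l) + (M + m + l)"
      using less[OF that]
      by (intro order.trans[OF degree_mult_le])
        (simp add: degree_higher_pderiv monic_OPS_degree[OF Q])
    then show ?thesis using that by simp
  qed
  then have "degree (\<Sum>l<j. smult (of_nat (m choose l)) ((pderiv ^^ l) (Q j) * \<Phi> l)) \<le> M + m + j"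
    by (intro degree_sum_le order.trans[OF degree_smult_le]) auto
  then show ?case
    by (subst Phi_poly.simps)
      (intro order.trans[OF degree_smult_le] degree_diff_le degree_psi; simp)
qed

text \<open>Only the last term of \<open>\<psi> 0\<close>, a multiple of \<open>P (m + M)\<close>,
  reaches this degree, and its coefficient contains \<open>c M 0\<close>.\<close>

lemma coeff_Phi_0: "coeff (\<Phi> 0) (M + m) \<noteq> 0"
proof -
  have "coeff (P (m + j)) (M + m) = (if j = M then 1 else 0)" if "j \<le> M" for j
    using that monic_OPS_monic[OF P, of "m + M"] monic_OPS_degree[OF P]
    by (auto simp: monic_def coeff_eq_0 add.commute)
  then have "coeff (\<psi> 0) (M + m) = (\<Sum>j=0..M. if j = M
      then (-1) ^ m * pochhammer (of_nat (j + 1)) m * c j 0 / u ((P (m + j))\<^sup>2) else 0)"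
    unfolding psi_poly_def coeff_sum by (intro sum.cong) auto
  \<comment> \<open>The condition on \<open>c n (n - M)\<close> at \<open>n = M\<close>.\<close>
  moreover have "c M 0 \<noteq> 0"
    using coherent unfolding coherent_relation_def by (metis diff_self_eq_0 order_refl)
  ultimately have "coeff (\<psi> 0) (M + m) \<noteq> 0"
    using pochhammer_nonzero[of M] monic_OPS_square[OF P] by simp
  then show ?thesis
    using monic_OPS_square[OF Q, of 0] by (subst Phi_poly.simps) simp
qed

lemma Phi_0_nonzero: "\<Phi> 0 \<noteq> 0"
  using coeff_Phi_0 by auto

lemma degree_Phi_0: "degree (\<Phi> 0) = M + m"
  using degree_Phi[of 0] coeff_Phi_0 by (simp add: le_degree order_antisym)

section \<open>Rational transformation, Pearson equations and class bounds\<close>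

lemma pi_v: "\<pi> \<cdot>\<^sub>f v = \<Phi> m \<cdot>\<^sub>f u"
  using funpow_fderiv_pi[of m] by simp

lemma pi_nonzero: "\<pi> \<noteq> 0"
  using monic_pi by (auto simp: monic_def)

lemma regular_u: "regular u" and regular_v: "regular v"
  using P Q by (auto simp: regular_def)

lemma Phi_m_nonzero: "\<Phi> m \<noteq> 0"
proof
  assume "\<Phi> m = 0"
  then have "v (\<pi> * q) = 0" for q
    using fun_cong[OF pi_v, of q] by (simp add: pmult_def functional_0 u)
  then show False
    using regular_pmult_eq_0[OF regular_v] pi_nonzero by blast
qed

lemma rationally_related: "rationally_related u v"
  unfolding rationally_related_def using pi_v pi_nonzero Phi_m_nonzero by metis

text \<open>Both sides are the derivative of order \<open>m - j\<close> of the functional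
  \<open>\<pi> \<cdot>\<^sub>f v\<close>.\<close>

lemma fderiv_Phi_Suc:
  assumes "j < m"
  shows "fderiv (\<Phi> (Suc j) \<cdot>\<^sub>f u) = \<Phi> j \<cdot>\<^sub>f u"
proof -
  have "m - j = Suc (m - Suc j)" using assms by simp
  then show ?thesis
    using funpow_fderiv_pi[of "Suc j"] funpow_fderiv_pi[of j] assms by simp
qed

lemma fderiv_Phi_pi:
  assumes "m \<ge> 1"
  shows "fderiv ((\<Phi> m * \<pi>) \<cdot>\<^sub>f v) = (pderiv (\<Phi> m) + \<Phi> (m - 1)) \<cdot>\<^sub>f \<pi> \<cdot>\<^sub>f v"
proof
  fix q
  have D: "fderiv (\<pi> \<cdot>\<^sub>f v) = \<Phi> (m - 1) \<cdot>\<^sub>f u"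
    using fderiv_Phi_Suc[of "m - 1"] assms by (simp add: pi_v)
  have "(\<Phi> m \<cdot>\<^sub>f fderiv (\<pi> \<cdot>\<^sub>f v)) q = (\<Phi> (m - 1) \<cdot>\<^sub>f \<pi> \<cdot>\<^sub>f v) q"
    \<comment> \<open>Commuting \<open>\<Phi> m\<close> past \<open>\<Phi> (m - 1)\<close> matches
      both sides as multiples of \<open>u\<close>. \<open>D\<close> is unfolded first, since
      \<open>pi_v\<close> would rewrite inside its left-hand side.\<close>
    unfolding D unfolding pi_v by (simp add: pmult_pmult mult.commute)
  then show "fderiv ((\<Phi> m * \<pi>) \<cdot>\<^sub>f v) q = ((pderiv (\<Phi> m) + \<Phi> (m - 1)) \<cdot>\<^sub>f \<pi> \<cdot>\<^sub>f v) q"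
    unfolding pmult_pmult[symmetric] fderiv_pmult[OF functional_pmult[OF v]]
    by (simp add: pmult_def distrib_left distrib_right functional_add v)
qed

text \<open>Nonvanishing is known for \<open>\<Phi> 0\<close> from its leading coefficient and
  passes to \<open>\<Phi> 1\<close>.\<close>

lemma pearson_u: "m \<ge> 1 \<Longrightarrow> pearson u (\<Phi> 1) (\<Phi> 0)"
  using pearson_iff[OF regular_u] fderiv_Phi_Suc[of 0] Phi_0_nonzero by auto

text \<open>Here the left-hand polynomial is known to be nonzero, as a product of nonzero factors,
  and nonvanishing passes to the right-hand one.\<close>

lemma pearson_v:
  "m \<ge> 1 \<Longrightarrow> pearson v (\<Phi> m * \<pi>) ((pderiv (\<Phi> m) + \<Phi> (m - 1)) * \<pi>)"
  using pearson_iff(1)[OF regular_v] fderiv_Phi_pi Phi_m_nonzero pi_nonzero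
  by (simp add: pmult_pmult)

lemma sclass_u:
  assumes "m \<ge> 1"
  shows "sclass u \<le> int M + int m - 1"
  using sclass_le[OF pearson_u[OF assms]] degree_Phi[of 1] degree_Phi_0 by simp

text \<open>The degree bounds \<open>N + M + 2 * m\<close> and \<open>N + M + 2 * m - 1\<close> give
  the same value in both entries of the maximum.\<close>

lemma sclass_v:
  assumes "m \<ge> 1"
  shows "sclass v \<le> int N + int M + 2 * (int m - 1)"
proof -
  have "degree (\<Phi> m * \<pi>) \<le> (M + m + m) + N"
    using degree_Phi[of m] by (intro order.trans[OF degree_mult_le]) simp
  moreover have "degree (pderiv (\<Phi> m) + \<Phi> (m - 1)) \<le> M + m + (m - 1)"
    using degree_Phi[of m] degree_Phi[of "m - 1"] assms
    by (intro degree_add_le) (auto simp: degree_pderiv)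
  then have "degree ((pderiv (\<Phi> m) + \<Phi> (m - 1)) * \<pi>) \<le> M + m + (m - 1) + N"
    by (intro order.trans[OF degree_mult_le]) simp
  ultimately show ?thesis
    using sclass_le[OF pearson_v[OF assms]] assms by auto
qed

end

text \<open>The differential equations are stated for \<open>m \<ge> 1\<close>: at
  \<open>m = 0\<close> division by zero makes \<open>\<Phi> 1\<close> zero while
  \<open>\<Phi> 0\<close> is not, and \<open>m - 1\<close> is truncated.\<close>

theorem theorem2p3:
  fixes M N m :: nat
    and \<pi> :: "complex poly"
    and P Q :: "nat \<Rightarrow> complex poly"
    and c :: "nat \<Rightarrow> nat \<Rightarrow> complex"
    and u v :: pfun
    and \<Phi> :: "nat \<Rightarrow> complex poly"
  assumes "monic \<pi>" and "degree \<pi> = N"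
    and "monic_OPS u P" and "monic_OPS v Q"
    and "coherent_relation \<pi> M m P Q c"
    and "N = 0 \<Longrightarrow> m \<ge> 1"
  defines "\<Phi> \<equiv> Phi_poly u v P Q c N M m"
  shows "rationally_related u v
    \<and> \<Phi> 0 \<noteq> 0 \<and> degree (\<Phi> 0) = M + m
    \<and> (\<forall>j\<in>{1..m}. degree (\<Phi> j) \<le> M + m + j)
    \<and> \<pi> \<cdot>\<^sub>f v = \<Phi> m \<cdot>\<^sub>f u
    \<and> (m \<ge> 1 \<longrightarrow>
         semiclassical u \<and> semiclassical v
       \<and> fderiv (\<Phi> 1 \<cdot>\<^sub>f u) = \<Phi> 0 \<cdot>\<^sub>f u
       \<and> fderiv ((\<Phi> m * \<pi>) \<cdot>\<^sub>f v) = (pderiv (\<Phi> m) + \<Phi> (m - 1)) \<cdot>\<^sub>f \<pi> \<cdot>\<^sub>f v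
       \<and> sclass u \<le> int M + int m - 1
       \<and> sclass v \<le> int N + int M + 2 * (int m - 1))"
proof -
  interpret coherent_pair M m \<pi> P Q c u v
    using assms by unfold_locales
  show ?thesis
    unfolding \<Phi>_def \<open>degree \<pi> = N\<close>[symmetric] semiclassical_def
    using rationally_related Phi_0_nonzero degree_Phi_0 degree_Phi pi_v regular_u regular_v
      pearson_u pearson_v fderiv_Phi_Suc[of 0] fderiv_Phi_pi sclass_u sclass_v
    by (auto simp: Suc_le_eq)
qed

end
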